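(* Let $A_1,\dots,A_{2l}\in M_n(\mathbb{C})$ ($l\le n^2$) be $\mathbb{R}$-linearly independent invertible matrices. For $H\in M_n(\mathbb{C})$ let $T(H)$ be the real $2n^2\times 2l$ matrix whose $i$-th column is $\mathrm{Vec}_{\mathbb{R}}(HA_i)$. Let $i\neq j$ be in $\{1,\dots,2l\}$. Then the $i$-th and $j$-th columns of $T(H)$ are orthogonal as vectors in $\mathbb{R}^{2n^2}$ for all matrices $H\in M_n(\mathbb{C})$ if and only if $A_iA_j^*+A_jA_i^*=0$.
   Context: $A^*$ denotes the conjugate transpose of $A$. For $A\in M_n(\mathbb{C})$, $\mathrm{Vec}_{\mathbb{R}}(A)\in\mathbb{R}^{2n^2}$ is obtained by stacking the entries of $A$ in a fixed order (e.g. column by column) into a vector $(v_1,\dots,v_{n^2})\in\mathbb{C}^{n^2}$ and then forming $(\mathrm{Re}\,v_1,\mathrm{Im}\,v_1,\dots,\mathrm{Re}\,v_{n^2},\mathrm{Im}\,v_{n^2})^t$. Orthogonality in $\mathbb{R}^{2n^2}$ is with respect to the usual dot product. *)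

theory Defs
  imports "Jordan_Normal_Form.Schur_Decomposition"
begin

text \<open>Column-by-column stacking: entry \<open>(r, s)\<close> of an \<open>nr \<times> nc\<close> matrix sits at position
  \<open>m = s * nr + r\<close> of the stacked complex vector; its real and imaginary parts sit at positions
  \<open>2 * m\<close> and \<open>2 * m + 1\<close> of the real vector.\<close>

definition vec_real :: "complex mat \<Rightarrow> real vec" where
  "vec_real A = vec (2 * (dim_row A * dim_col A))
     (\<lambda>k. let m = k div 2; z = A $$ (m mod dim_row A, m div dim_row A)
          in if even k then Re z else Im z)"

definition real_lin_indep :: "nat \<Rightarrow> nat \<Rightarrow> (nat \<Rightarrow> complex mat) \<Rightarrow> bool" where
  "real_lin_indep n m A \<longleftrightarrow>
     (\<forall>c :: nat \<Rightarrow> real.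
        finsum (module_mat TYPE(complex) n n) (\<lambda>k. complex_of_real (c k) \<cdot>\<^sub>m A k) {..<m} = 0\<^sub>m n n
        \<longrightarrow> (\<forall>k<m. c k = 0))"

definition T_mat :: "nat \<Rightarrow> nat \<Rightarrow> (nat \<Rightarrow> complex mat) \<Rightarrow> complex mat \<Rightarrow> real mat" where
  "T_mat n m A H = mat_of_cols (2 * n\<^sup>2) (map (\<lambda>i. vec_real (H * A i)) [0..<m])"

end

theory Submission
  imports Defs
begin

text \<open>The dot product of \<open>vec_real X\<close> and \<open>vec_real Y\<close> is \<open>Re tr (X Y\<^sup>*)\<close>. Put
  \<open>Q = X Y\<^sup>* + Y X\<^sup>*\<close>. By symmetry of the dot product,
  \<open>2 \<langle>H X, H Y\<rangle> = Re tr (H Q H\<^sup>*)\<close>, which vanishes for all \<open>H\<close> if \<open>Q = 0\<close>. Conversely, if this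
  quadratic form in \<open>H\<close> vanishes, so does its polarization
  \<open>\<langle>X, Q Y\<rangle> + \<langle>Q X, Y\<rangle> = Re tr (Q Q\<^sup>*)\<close> at the pair \<open>(1, Q)\<close>, and hence \<open>Q = 0\<close>.\<close>

lemma sum_pairs:
  fixes f :: "nat \<Rightarrow> 'a::comm_monoid_add"
  shows "(\<Sum>k<2 * m. f k) = (\<Sum>k<m. f (2 * k) + f (2 * k + 1))"
  by (induction m) (simp_all add: ac_simps)

text \<open>Cutting the range into \<open>b\<close> consecutive blocks of length \<open>a\<close>
  makes \<open>m div a\<close> the number of the block and \<open>m mod a\<close> the offset inside
  it. This turns a sum along the column stacking into a double sum over matrix entries.\<close>

lemma sum_div_mod:
  fixes f :: "nat \<Rightarrow> nat \<Rightarrow> 'a::comm_monoid_add"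
  shows "(\<Sum>m<a * b. f (m mod a) (m div a)) = (\<Sum>r<a. \<Sum>s<b. f r s)"
proof -
  have "(\<Sum>m<a * b. f (m mod a) (m div a)) = (\<Sum>m<b * a. f (m mod a) (m div a))"
    by (simp add: mult.commute)
  also have "\<dots> = (\<Sum>s<b. \<Sum>m=s * a..<s * a + a. f (m mod a) (m div a))"
    by (simp add: sum.nat_group)
  also have "\<dots> = (\<Sum>s<b. \<Sum>r<a. f r s)"
  proof (rule sum.cong[OF refl])
    fix s
    have "(\<Sum>m=s * a..<s * a + a. f (m mod a) (m div a))
        = (\<Sum>r=0..<a. f ((r + s * a) mod a) ((r + s * a) div a))"
      using sum.shift_bounds_nat_ivl[of "\<lambda>m. f (m mod a) (m div a)" 0 "s * a" a]
      by (simp add: add.commute)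
    then show "(\<Sum>m=s * a..<s * a + a. f (m mod a) (m div a)) = (\<Sum>r<a. f r s)"
      by (simp add: atLeast0LessThan)
  qed
  also have "\<dots> = (\<Sum>r<a. \<Sum>s<b. f r s)"
    by (rule sum.swap)
  finally show ?thesis .
qed

lemma vec_real_scalar_prod:
  assumes "X \<in> carrier_mat n m" and "Y \<in> carrier_mat n m"
  shows "vec_real X \<bullet> vec_real Y = (\<Sum>r<n. \<Sum>s<m. Re (X $$ (r, s) * cnj (Y $$ (r, s))))"
proof -
  have "vec_real X \<bullet> vec_real Y = (\<Sum>k<2 * (n * m). vec_real X $ k * vec_real Y $ k)"
    using assms by (simp add: scalar_prod_def vec_real_def atLeast0LessThan)
  \<comment> \<open>Positions \<open>2 * k\<close> and \<open>2 * k + 1\<close> hold the two parts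
    of the same entry, and Re x Re y + Im x Im y = Re (x cnj y).\<close>
  also have "\<dots> = (\<Sum>k<n * m. Re (X $$ (k mod n, k div n) * cnj (Y $$ (k mod n, k div n))))"
    unfolding sum_pairs using assms
    by (intro sum.cong refl) (auto simp: vec_real_def Let_def)
  also have "\<dots> = (\<Sum>r<n. \<Sum>s<m. Re (X $$ (r, s) * cnj (Y $$ (r, s))))"
    by (rule sum_div_mod)
  finally show ?thesis .
qed


lemma dim_mat_adjoint [simp]:
  "dim_row (mat_adjoint A) = dim_col A" "dim_col (mat_adjoint A) = dim_row A"
  by (simp_all add: mat_adjoint_def)

lemma mat_adjoint_carrier [simp]:
  "mat_adjoint A \<in> carrier_mat m n \<longleftrightarrow> A \<in> carrier_mat n m"
  by (auto simp only: carrier_mat_def mem_Collect_eq dim_mat_adjoint)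

lemma index_mat_adjoint [simp]:
  "r < dim_col A \<Longrightarrow> s < dim_row A \<Longrightarrow> mat_adjoint A $$ (r, s) = conjugate (A $$ (s, r))"
  by (simp add: mat_adjoint_def mat_of_rows_index conjugate_vec_def)

lemma mat_adjoint_mult:
  fixes A B :: "complex mat"
  assumes "A \<in> carrier_mat n m" and "B \<in> carrier_mat m k"
  shows "mat_adjoint (A * B) = mat_adjoint B * mat_adjoint A"
  using assms by (intro eq_matI) (auto simp: scalar_prod_def intro!: sum.cong)

lemma vec_real_dim: "A \<in> carrier_mat n m \<Longrightarrow> vec_real A \<in> carrier_vec (2 * (n * m))"
  by (auto simp: vec_real_def)

lemma vec_real_add:
  assumes "A \<in> carrier_mat n m" and "B \<in> carrier_mat n m"
  shows "vec_real (A + B) = vec_real A + vec_real B"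
proof (rule eq_vecI)
  fix k assume "k < dim_vec (vec_real A + vec_real B)"
  then have k: "k < 2 * (n * m)"
    using assms by (simp add: vec_real_def)
  \<comment> \<open>The bound on \<open>k\<close> excludes \<open>n = 0\<close>, where
    \<open>mod n\<close> would give no valid row index.\<close>
  then have "0 < n" by (cases n) auto
  then have "k div 2 mod n < n" by simp
  moreover have "k div 2 div n < m"
    using k by (auto intro!: less_mult_imp_div_less simp: mult.commute)
  ultimately show "vec_real (A + B) $ k = (vec_real A + vec_real B) $ k"
    using k assms by (simp add: vec_real_def Let_def)
qed (use assms in \<open>simp add: vec_real_def\<close>)

definition mat_trace :: "'a::comm_monoid_add mat \<Rightarrow> 'a" where
  "mat_trace A = (\<Sum>r<dim_row A. A $$ (r, r))"

lemma mat_trace_add: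
  assumes "A \<in> carrier_mat n n" and "B \<in> carrier_mat n n"
  shows "mat_trace (A + B) = mat_trace A + mat_trace B"
  using assms by (simp add: mat_trace_def sum.distrib)

lemma vec_real_scalar_prod_trace:
  assumes "X \<in> carrier_mat n m" and "Y \<in> carrier_mat n m"
  shows "vec_real X \<bullet> vec_real Y = Re (mat_trace (X * mat_adjoint Y))"
  unfolding vec_real_scalar_prod[OF assms] mat_trace_def using assms
  by (auto simp: scalar_prod_def atLeast0LessThan intro!: sum.cong)

text \<open>The dot product of \<open>vec_real X\<close> with itself is the sum of the squared
  moduli of the entries.\<close>

lemma vec_real_scalar_prod_self_eq_0:
  assumes "X \<in> carrier_mat n m" and "vec_real X \<bullet> vec_real X = 0"
  shows "X = 0\<^sub>m n m"
proof -
  have "(\<Sum>r<n. \<Sum>s<m. (cmod (X $$ (r, s)))\<^sup>2) = 0"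
    using assms vec_real_scalar_prod[of X n m X]
    by (simp only: cmod_power2) (simp add: power2_eq_square)
  then have "\<forall>r<n. \<forall>s<m. X $$ (r, s) = 0"
    by (simp add: sum_nonneg_eq_0_iff sum_nonneg)
  then show ?thesis
    using assms by (intro eq_matI) auto
qed

lemma vec_real_orthogonal_iff:
  fixes X Y :: "complex mat"
  assumes X: "X \<in> carrier_mat n n" and Y: "Y \<in> carrier_mat n n"
  shows "(\<forall>H \<in> carrier_mat n n. vec_real (H * X) \<bullet> vec_real (H * Y) = 0)
     \<longleftrightarrow> X * mat_adjoint Y + Y * mat_adjoint X = 0\<^sub>m n n"
    (is "?L \<longleftrightarrow> _")
proof -
  define Q where "Q = X * mat_adjoint Y + Y * mat_adjoint X"
  have comm: "vec_real U \<bullet> vec_real V = vec_real V \<bullet> vec_real U"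
    if "U \<in> carrier_mat n n" "V \<in> carrier_mat n n" for U V
    using that by (intro comm_scalar_prod[where n = "2 * (n * n)"] vec_real_dim)
  have Q: "Q \<in> carrier_mat n n" using X Y by (simp add: Q_def)
  have ?L if Q0: "Q = 0\<^sub>m n n"
  proof
    fix H :: "complex mat" assume H: "H \<in> carrier_mat n n"
    \<comment> \<open>The adjoint reverses products, so \<open>H\<close> and its adjoint end up as
      outer factors that do not depend on \<open>U\<close> and \<open>V\<close>.\<close>
    have *: "(H * U) * mat_adjoint (H * V) = H * (U * mat_adjoint V) * mat_adjoint H"
      if "U \<in> carrier_mat n n" "V \<in> carrier_mat n n" for U V
      using that H by (simp add: mat_adjoint_mult[of _ n n _ n] assoc_mult_mat[of _ n n _ n _ n])
    \<comment> \<open>Adding the product with its arguments swapped symmetrizes the inner factor to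
      \<open>Q\<close>; by \<open>comm\<close> the sum is twice the original product.\<close>
    have "vec_real (H * X) \<bullet> vec_real (H * Y) + vec_real (H * Y) \<bullet> vec_real (H * X)
        = Re (mat_trace (H * (X * mat_adjoint Y) * mat_adjoint H
            + H * (Y * mat_adjoint X) * mat_adjoint H))"
      using X Y H by (simp add: vec_real_scalar_prod_trace[of _ n n] * mat_trace_add[of _ n]
          mult_carrier_mat[of _ n n _ n])
    also have "H * (X * mat_adjoint Y) * mat_adjoint H
            + H * (Y * mat_adjoint X) * mat_adjoint H = H * Q * mat_adjoint H"
      using X Y H by (simp add: Q_def add_mult_distrib_mat[of _ n n _ _ n]
          mult_add_distrib_mat[of _ n n _ n])
    also have "Re (mat_trace \<dots>) = 0"
      using H by (simp add: Q0 mat_trace_def)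
    finally show "vec_real (H * X) \<bullet> vec_real (H * Y) = 0"
      using X Y H comm[of "H * X" "H * Y"] by simp
  qed
  moreover have "Q = 0\<^sub>m n n" if L: ?L
  proof -
    have QX: "Q * X \<in> carrier_mat n n" and QY: "Q * Y \<in> carrier_mat n n"
      using X Y Q by simp_all
    note dims = X[THEN vec_real_dim] Y[THEN vec_real_dim] QX[THEN vec_real_dim] QY[THEN vec_real_dim]
    \<comment> \<open>polarize the quadratic form \<open>H \<mapsto> vec_real (H * X) \<bullet> vec_real (H * Y)\<close> at \<open>1\<close> and \<open>Q\<close>\<close>
    have "vec_real ((1\<^sub>m n + Q) * X) \<bullet> vec_real ((1\<^sub>m n + Q) * Y) = 0"
      using L Q by simp
    moreover have "(1\<^sub>m n + Q) * X = X + Q * X" "(1\<^sub>m n + Q) * Y = Y + Q * Y"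
      using X Y Q by (simp_all add: add_mult_distrib_mat[of _ n n _ _ n])
    ultimately have "vec_real X \<bullet> vec_real Y + vec_real X \<bullet> vec_real (Q * Y)
        + (vec_real (Q * X) \<bullet> vec_real Y + vec_real (Q * X) \<bullet> vec_real (Q * Y)) = 0"
      using X Y QX QY dims
      by (simp add: vec_real_add[of _ n n] add_scalar_prod_distrib[of _ "2 * (n * n)"]
          scalar_prod_add_distrib[of _ "2 * (n * n)"])
    moreover have "vec_real X \<bullet> vec_real Y = 0"
      using L X Y by (force dest: bspec[of _ _ "1\<^sub>m n"])
    \<comment> \<open>The two unmixed terms are the form at \<open>1\<close> and at
      \<open>Q\<close>, both zero. The second mixed term is flipped so that \<open>Q\<close> stands
      under the adjoint in both.\<close>
    ultimately have "vec_real X \<bullet> vec_real (Q * Y) + vec_real Y \<bullet> vec_real (Q * X) = 0"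
      using L Q comm[OF Y QX] by simp
    then have "Re (mat_trace (X * mat_adjoint (Q * Y) + Y * mat_adjoint (Q * X))) = 0"
      using X Y QX QY by (simp add: vec_real_scalar_prod_trace[of _ n n] mat_trace_add[of _ n])
    \<comment> \<open>Both summands end in the adjoint of \<open>Q\<close>; factoring it out on the
      right leaves the definition of \<open>Q\<close>.\<close>
    moreover have "X * mat_adjoint (Q * Y) + Y * mat_adjoint (Q * X) = Q * mat_adjoint Q"
    proof -
      have "X * mat_adjoint (Q * Y) + Y * mat_adjoint (Q * X)
          = (X * mat_adjoint Y + Y * mat_adjoint X) * mat_adjoint Q"
        using X Y Q by (simp add: mat_adjoint_mult[of _ n n _ n] add_mult_distrib_mat[of _ n n _ _ n]
            assoc_mult_mat[of _ n n _ n _ n])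
      then show ?thesis by (simp only: Q_def)
    qed
    ultimately have "vec_real Q \<bullet> vec_real Q = 0"
      using vec_real_scalar_prod_trace[OF Q Q] by simp
    then show ?thesis
      by (rule vec_real_scalar_prod_self_eq_0[OF Q])
  qed
  ultimately show ?thesis
    unfolding Q_def by blast
qed

theorem theorem1:
  fixes n l i j :: nat and A :: "nat \<Rightarrow> complex mat"
  assumes "l \<le> n\<^sup>2"
    and "\<And>k. k < 2 * l \<Longrightarrow> A k \<in> carrier_mat n n"
    and "real_lin_indep n (2 * l) A"
    and "\<And>k. k < 2 * l \<Longrightarrow> invertible_mat (A k)"
    and "i < 2 * l" and "j < 2 * l" and "i \<noteq> j"
  shows "(\<forall>H \<in> carrier_mat n n. col (T_mat n (2 * l) A H) i \<bullet> col (T_mat n (2 * l) A H) j = 0)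
     \<longleftrightarrow> A i * mat_adjoint (A j) + A j * mat_adjoint (A i) = 0\<^sub>m n n"
proof -
  \<comment> \<open>The stacked vector has length \<open>2 * (n * n)\<close>, the row count in
    \<open>T_mat\<close>, so the column is returned unchanged.\<close>
  have "col (T_mat n (2 * l) A H) k = vec_real (H * A k)"
    if "H \<in> carrier_mat n n" and "k < 2 * l" for H k
    using that vec_real_dim[of "H * A k" n n] assms(2)[of k]
    by (simp add: T_mat_def power2_eq_square)
  then show ?thesis
    using assms vec_real_orthogonal_iff[of "A i" n "A j"] by simp
qed

end
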